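(* Let $g\geq 1$ be an integer, let $\varepsilon\in\{1,-1\}$, and let $p=6g+\varepsilon$. Let $i$ be an integer with $0\leq i\leq p-1$ such that \[ i\not\equiv \frac{p^2-1}{12}\pmod p \] and \[ i\not\equiv (k-g)(3k-3g-\varepsilon)\pmod p\qquad\text{for every integer } k \text{ with } 1\leq k\leq \frac{p-1}{2}. \] Then for all integers $n\geq 0$, \[ \mathcal{EO}_u(2pn+2i)\equiv 0\pmod 2. \]
   Context: For a positive integer $k$, let $f_k:=(q^k;q^k)_\infty=\prod_{i=1}^\infty(1-q^{ki})$. The integers $\mathcal{EO}_u(n)$, $n\ge 0$, are defined by $\sum_{n=0}^\infty \mathcal{EO}_u(n)q^n=\dfrac{f_4^2}{f_2^2}$. The integer $p$ is not assumed to be prime. *)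

theory Defs
  imports
    "HOL-Analysis.Infinite_Products"
    "HOL-Computational_Algebra.Formal_Power_Series"
    "HOL-Number_Theory.Cong"
begin

text \<open>
  The infinite product is taken in the \<open>fps_X\<close>-adic topology on integer power series, i.e. the
  metric of the \<^typ>\<open>int fps\<close> type. The factor with index \<open>i\<close> of the usual product over
  \<open>i \<ge> 1\<close> is the factor with index \<open>i - 1\<close> here.
\<close>

definition eta_prod :: "nat \<Rightarrow> int fps" where
  "eta_prod k = prodinf (\<lambda>i. 1 - fps_X ^ (k * Suc i))"

text \<open>
  \<^typ>\<open>int\<close> is not of class \<^class>\<open>inverse\<close>, so division of \<^typ>\<open>int fps\<close> is not available. Since
  \<open>eta_prod 2\<close> has constant coefficient \<open>1\<close>, its square has a multiplicative inverse, computed by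
  \<open>fps_right_inverse\<close> with constant coefficient \<open>1\<close>; see \<open>EO_u_gf\<close> below.
\<close>

definition EO_u :: "nat \<Rightarrow> int" where
  "EO_u n = fps_nth (eta_prod 4 ^ 2 * fps_right_inverse (eta_prod 2 ^ 2) 1) n"

lemma eta_prod_partial_nth:
  assumes "k > 0" "n \<le> m"
  shows "fps_nth (\<Prod>i\<le>m. 1 - fps_X ^ (k * Suc i) :: int fps) n
       = fps_nth (\<Prod>i\<le>n. 1 - fps_X ^ (k * Suc i) :: int fps) n"
  using assms(2)
proof (induction m rule: dec_induct)
  case (step m)
  have less: "n < k * Suc (Suc m)"
  proof -
    have "n < Suc (Suc m)"
      using step(1) by simp
    also have "1 * Suc (Suc m) \<le> k * Suc (Suc m)"
      using assms(1) by (intro mult_le_mono1) simp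
    finally show ?thesis
      by (simp only: mult_1)
  qed
  have "fps_nth (\<Prod>i\<le>Suc m. 1 - fps_X ^ (k * Suc i) :: int fps) n
      = fps_nth ((\<Prod>i\<le>m. 1 - fps_X ^ (k * Suc i)) * (1 - fps_X ^ (k * Suc (Suc m))) :: int fps) n"
    by (simp only: prod.atMost_Suc)
  also have "\<dots> = fps_nth (\<Prod>i\<le>m. 1 - fps_X ^ (k * Suc i) :: int fps) n"
    using less by (simp only: right_diff_distrib fps_sub_nth mult_1_right
      fps_X_power_mult_right_nth if_True diff_zero)
  also note step.IH
  finally show ?case .
qed simp

lemma eta_prod_has_prod:
  assumes "k > 0"
  shows "(\<lambda>i. 1 - fps_X ^ (k * Suc i) :: int fps) has_prod eta_prod k"
    and "fps_nth (eta_prod k) 0 = 1"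
proof -
  define L :: "int fps" where
    "L = Abs_fps (\<lambda>n. fps_nth (\<Prod>i\<le>n. 1 - fps_X ^ (k * Suc i)) n)"
  have "(\<lambda>n. \<Prod>i\<le>n. 1 - fps_X ^ (k * Suc i)) \<longlonglongrightarrow> L"
  proof (rule tendsto_fpsI)
    fix n
    show "\<forall>\<^sub>F m in sequentially. fps_nth (\<Prod>i\<le>m. 1 - fps_X ^ (k * Suc i)) n = fps_nth L n"
      using eventually_ge_at_top[of n]
      by eventually_elim (unfold L_def fps_nth_Abs_fps, rule eta_prod_partial_nth[OF assms])
  qed
  moreover have L0: "fps_nth L 0 = 1"
    using assms by (simp add: L_def)
  moreover from L0 have "L \<noteq> 0"
    by auto
  ultimately have *: "(\<lambda>i. 1 - fps_X ^ (k * Suc i)) has_prod L"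
    by (simp add: has_prod_def raw_has_prod_def)
  have "eta_prod k = L"
    unfolding eta_prod_def using * by (rule has_prod_unique[symmetric])
  with * L0 show "(\<lambda>i. 1 - fps_X ^ (k * Suc i)) has_prod eta_prod k"
    and "fps_nth (eta_prod k) 0 = 1"
    by simp_all
qed

lemma EO_u_gf: "Abs_fps EO_u * eta_prod 2 ^ 2 = eta_prod 4 ^ 2"
proof -
  let ?I = "fps_right_inverse (eta_prod 2 ^ 2) 1"
  have inv: "eta_prod 2 ^ 2 * ?I = 1"
  proof (rule fps_right_inverse)
    have "fps_nth (eta_prod 2 ^ 2) 0 = fps_nth (eta_prod 2) 0 * fps_nth (eta_prod 2) 0"
      by (simp only: power2_eq_square fps_mult_nth_0)
    then show "fps_nth (eta_prod 2 ^ 2) 0 * 1 = 1"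
      by (simp only: eta_prod_has_prod(2)[of 2] zero_less_numeral mult_1_right)
  qed
  have "Abs_fps EO_u = eta_prod 4 ^ 2 * ?I"
    by (rule fps_ext) (simp only: EO_u_def fps_nth_Abs_fps)
  then have "Abs_fps EO_u * eta_prod 2 ^ 2 = eta_prod 4 ^ 2 * (?I * eta_prod 2 ^ 2)"
    by (simp only: mult.assoc)
  also have "?I * eta_prod 2 ^ 2 = 1"
    by (rule trans[OF mult.commute inv])
  finally show ?thesis
    by (simp only: mult_1_right)
qed

end

theory Submission
  imports Defs
begin

text \<open>
  Modulo 2 we have \<open>f\<^sub>2\<^sup>2 \<equiv> f\<^sub>4\<close>, so the generating function \<open>f\<^sub>4\<^sup>2 / f\<^sub>2\<^sup>2\<close> is congruent to \<open>f\<^sub>4\<close>, which by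
  Euler's pentagonal number theorem is supported on the exponents \<open>2 m (3 m - \<epsilon>)\<close> with \<open>m \<in> \<int>\<close>.
  Putting \<open>m = k - g\<close> gives \<open>m (3 m - \<epsilon>) = 3 k\<^sup>2 - k p + (p\<^sup>2 - 1) / 12\<close>, an even function of \<open>k\<close>
  modulo \<open>p\<close>, so that all its residues are attained for \<open>0 \<le> k \<le> (p - 1) / 2\<close>. The pentagonal
  number theorem is obtained from Shanks' finite version of it.
\<close>

section \<open>Shanks' finite form of the pentagonal number theorem\<close>

lemma sum_telescope_Suc:
  fixes U :: "nat \<Rightarrow> 'a::ab_group_add"
  shows "(\<Sum>s\<le>n. U (Suc s) - U s) = U (Suc n) - U 0"
  by (induction n) simp_all

text \<open>Induction on \<open>n\<close>: raising \<open>n\<close> by one changes the summand with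
  index \<open>s\<close> by a difference \<open>U (Suc s) - U s\<close>. After telescoping, the
  boundary term \<open>U (Suc n)\<close> and the new summand \<open>T (Suc n) (Suc n)\<close> are
  exactly the two new pentagonal powers.\<close>

theorem shanks_identity:
  fixes x :: "'a::comm_ring_1"
  shows "(\<Sum>s\<le>n. (-1) ^ s * (\<Prod>j\<in>{s<..n}. 1 - x ^ j) * x ^ (s * n + s * (s + 1) div 2))
       = 1 + (\<Sum>s=1..n. (-1) ^ s * (x ^ (s * (3 * s - 1) div 2) + x ^ (s * (3 * s + 1) div 2)))"
proof (induction n)
  case (Suc n)
  define A where "A = (\<lambda>n s. \<Prod>j\<in>{s<..n}. 1 - x ^ j)"
  define T where "T = (\<lambda>n s. (-1) ^ s * A n s * x ^ (s * n + s * (s + 1) div 2))"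
  \<comment> \<open>The value 0 at \<open>s = 0\<close> is set by hand because \<open>s - 1\<close>
    truncates. It stands for a product containing the factor \<open>1 - x ^ 0\<close>, so the
    formula \<open>Us\<close> below also covers \<open>s = 0\<close>.\<close>
  define U where "U = (\<lambda>s. if s = 0 then 0 else
    (-1) ^ s * A n (s - 1) * x ^ (s * n + s * (s + 1) div 2))"
  have step: "T (Suc n) s - T n s = U (Suc s) - U s" if "s \<le> n" for s
  proof -
    have tri: "Suc s * (Suc s + 1) div 2 = s * (s + 1) div 2 + s + 1"
      by simp
    have "{s<..Suc n} = insert (Suc n) {s<..n}"
      using that by auto
    then have A1: "A (Suc n) s = (1 - x ^ Suc n) * A n s"
      by (simp add: A_def)
    have A2: "A n (s - 1) = (1 - x ^ s) * A n s" if "s \<noteq> 0"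
    proof -
      have "{s - 1<..n} = insert s {s<..n}"
        using that \<open>s \<le> n\<close> by auto
      then show ?thesis
        by (simp add: A_def)
    qed
    have Us: "U s = (-1) ^ s * ((1 - x ^ s) * A n s) * x ^ (s * n + s * (s + 1) div 2)"
      using A2 by (simp add: U_def)
    define e where "e = s * (s + 1) div 2"
    have "U (Suc s) = (-1) ^ Suc s * A n s * x ^ (Suc s * n + (e + s + 1))"
      unfolding U_def tri e_def by simp
    moreover have "T (Suc n) s = (-1) ^ s * ((1 - x ^ Suc n) * A n s) * x ^ (s * Suc n + e)"
      unfolding T_def A1 e_def ..
    moreover have "T n s = (-1) ^ s * A n s * x ^ (s * n + e)"
      unfolding T_def e_def ..
    ultimately show ?thesis
      unfolding Us e_def[symmetric] by (simp add: algebra_simps power_add)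
  qed
  have "(\<Sum>s\<le>Suc n. T (Suc n) s) = (\<Sum>s\<le>n. T n s + (U (Suc s) - U s)) + T (Suc n) (Suc n)"
    by (simp add: step[symmetric])
  also have "\<dots> = (\<Sum>s\<le>n. T n s) + U (Suc n) + T (Suc n) (Suc n)"
    unfolding sum.distrib sum_telescope_Suc by (simp add: U_def)
  also have "U (Suc n) = (-1) ^ Suc n * x ^ (Suc n * (3 * Suc n - 1) div 2)"
  proof -
    have "Suc n * (3 * Suc n - 1) = 2 * (Suc n * n) + Suc n * (Suc n + 1)"
      by (simp add: algebra_simps)
    then have "Suc n * (3 * Suc n - 1) div 2 = Suc n * n + Suc n * (Suc n + 1) div 2"
      by (simp only: div_mult_self4[OF zero_neq_numeral[symmetric]])
    then show ?thesis
      by (simp only: U_def A_def) simp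
  qed
  also have "T (Suc n) (Suc n) = (-1) ^ Suc n * x ^ (Suc n * (3 * Suc n + 1) div 2)"
  proof -
    have "Suc n * (3 * Suc n + 1) = 2 * (Suc n * Suc n) + Suc n * (Suc n + 1)"
      by (simp add: algebra_simps)
    then have "Suc n * (3 * Suc n + 1) div 2 = Suc n * Suc n + Suc n * (Suc n + 1) div 2"
      by (simp only: div_mult_self4[OF zero_neq_numeral[symmetric]])
    then show ?thesis
      by (simp only: T_def A_def) simp
  qed
  finally show ?case
    using Suc.IH unfolding T_def A_def by (simp add: algebra_simps)
qed simp

section \<open>Coefficients of the infinite product\<close>

lemma eta_prod_nth:
  assumes "k > 0" "n \<le> m"
  shows "fps_nth (eta_prod k) n = fps_nth (\<Prod>i\<le>m. 1 - fps_X ^ (k * Suc i) :: int fps) n"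
proof -
  let ?f = "\<lambda>i. 1 - fps_X ^ (k * Suc i) :: int fps"
  \<comment> \<open>A nonzero value rules out the case of \<open>has_prod\<close> in which the
    product starts after a zero factor, so the partial products themselves converge to
    \<open>eta_prod k\<close>.\<close>
  have "eta_prod k \<noteq> 0"
    using eta_prod_has_prod(2)[OF assms(1)] by (metis fps_zero_nth zero_neq_one)
  then have "raw_has_prod ?f 0 (eta_prod k)"
    using eta_prod_has_prod(1)[OF assms(1)] unfolding has_prod_def by blast
  then have "(\<lambda>m. \<Prod>i\<le>m. ?f i) \<longlonglongrightarrow> eta_prod k"
    by (simp only: raw_has_prod_def add_0_right)
  then have "\<forall>\<^sub>F m in sequentially. fps_nth (\<Prod>i\<le>m. ?f i) n = fps_nth (eta_prod k) n"
    unfolding tendsto_fps_iff by blast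
  then obtain N where N: "\<And>l. l \<ge> N \<Longrightarrow> fps_nth (\<Prod>i\<le>l. ?f i) n = fps_nth (eta_prod k) n"
    unfolding eventually_sequentially by blast
  have "fps_nth (eta_prod k) n = fps_nth (\<Prod>i\<le>max N n. ?f i) n"
    by (rule N[symmetric]) (rule max.cobounded1)
  also have "\<dots> = fps_nth (\<Prod>i\<le>n. ?f i) n"
    by (rule eta_prod_partial_nth[OF assms(1) max.cobounded2])
  also have "\<dots> = fps_nth (\<Prod>i\<le>m. ?f i) n"
    by (rule eta_prod_partial_nth[OF assms, symmetric])
  finally show ?thesis .
qed

text \<open>In Shanks' identity at \<open>x = fps_X ^ k\<close>, all summands on the left with
  \<open>s > 0\<close> have order greater than \<open>n\<close>, and the summand with
  \<open>s = 0\<close> is a partial product of \<open>eta_prod k\<close>. Hence the coefficient can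
  be read off from the pentagonal powers on the right.\<close>

theorem eta_prod_nth_nonzero:
  assumes "k > 0" "fps_nth (eta_prod k) n \<noteq> 0"
  obtains m :: int where "2 * int n = int k * (m * (3 * m - 1))"
proof -
  define x :: "int fps" where "x = fps_X ^ k"
  \<comment> \<open>The upper limit is \<open>Suc n\<close> because the product over
    \<open>i \<le> n\<close> has the exponents \<open>k * 1\<close> up to
    \<open>k * Suc n\<close>.\<close>
  let ?T = "\<lambda>s. (-1) ^ s * (\<Prod>j\<in>{s<..Suc n}. 1 - x ^ j) * x ^ (s * Suc n + s * (s + 1) div 2)"
  let ?S = "\<lambda>s. (-1) ^ s * (x ^ (s * (3 * s - 1) div 2) + x ^ (s * (3 * s + 1) div 2))"
  have "(\<Prod>i\<le>n. 1 - fps_X ^ (k * Suc i)) = (\<Prod>i\<le>n. 1 - x ^ Suc i)"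
    by (simp only: x_def power_mult)
  also have "\<dots> = (\<Prod>j\<in>{0<..Suc n}. 1 - x ^ j)"
    by (rule prod.reindex_bij_witness[of _ "\<lambda>j. j - 1" Suc]) auto
  finally have P: "(\<Prod>i\<le>n. 1 - fps_X ^ (k * Suc i)) = ?T 0"
    by simp
  have small: "fps_nth (?T (Suc s)) n = 0" for s
  proof -
    have "n < 1 * (Suc s * Suc n + Suc s * (Suc s + 1) div 2)"
      by simp
    also have "\<dots> \<le> k * (Suc s * Suc n + Suc s * (Suc s + 1) div 2)"
      using assms(1) by (intro mult_le_mono1) simp
    finally show ?thesis
      by (simp only: x_def power_mult[symmetric] fps_X_power_mult_right_nth if_True)
  qed
  have "(\<Sum>s\<le>Suc n. ?T s) = ?T 0 + (\<Sum>s\<le>n. ?T (Suc s))"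
    by (rule sum.atMost_Suc_shift)
  then have "fps_nth (\<Sum>s\<le>Suc n. ?T s) n = fps_nth (?T 0) n"
    by (simp only: fps_add_nth fps_sum_nth small sum.neutral_const add_0_right)
  moreover have "fps_nth (?T 0) n \<noteq> 0"
    using assms(2) unfolding eta_prod_nth[OF assms(1) order.refl] P .
  ultimately have "fps_nth (1 + (\<Sum>s=1..Suc n. ?S s)) n \<noteq> 0"
    unfolding shanks_identity by simp
  then have "fps_nth (1 :: int fps) n + (\<Sum>s=1..Suc n. fps_nth (?S s) n) \<noteq> 0"
    by (simp only: fps_add_nth fps_sum_nth not_False_eq_True)
  then consider "fps_nth (1 :: int fps) n \<noteq> 0" | "(\<Sum>s=1..Suc n. fps_nth (?S s) n) \<noteq> 0"
    by linarith
  then consider "fps_nth (1 :: int fps) n \<noteq> 0" | s where "s \<ge> 1" "fps_nth (?S s) n \<noteq> 0"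
    by (metis (lifting) atLeastAtMost_iff sum.not_neutral_contains_not_neutral)
  then show ?thesis
  proof cases
    case 1
    then show ?thesis
      using that[of 0] by (auto split: if_splits)
  next
    case (2 s)
    then have "fps_nth (x ^ (s * (3 * s - 1) div 2) + x ^ (s * (3 * s + 1) div 2)) n \<noteq> 0"
      by (cases "even s") simp_all
    then have "n = k * (s * (3 * s - 1) div 2) \<or> n = k * (s * (3 * s + 1) div 2)"
      by (auto simp: x_def power_mult[symmetric] simp del: power_mult split: if_splits)
    moreover have "even (s * (3 * s - 1))" "even (s * (3 * s + 1))"
      using \<open>s \<ge> 1\<close> by auto
    ultimately have "2 * n = k * (s * (3 * s - 1)) \<or> 2 * n = k * (s * (3 * s + 1))"
      by (metis dvd_mult_div_cancel mult.left_commute)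
    then show ?thesis
    proof
      assume "2 * n = k * (s * (3 * s - 1))"
      then have "int (2 * n) = int (k * (s * (3 * s - 1)))"
        by simp
      then show ?thesis
        using \<open>s \<ge> 1\<close> by (intro that[of "int s"]) (simp add: of_nat_diff)
    next
      assume "2 * n = k * (s * (3 * s + 1))"
      then have "int (2 * n) = int (k * (s * (3 * s + 1)))"
        by simp
      then show ?thesis
        \<comment> \<open>The second family of exponents is the first one at negative arguments:
          (-s)(3(-s) - 1) = s(3s + 1).\<close>
        by (intro that[of "- int s"]) (simp add: algebra_simps)
    qed
  qed
qed

section \<open>Reduction modulo 2\<close>

lemma two_dvd_fps_iff:
  fixes a :: "int fps"
  shows "2 dvd a \<longleftrightarrow> (\<forall>n. even (fps_nth a n))"
proof
  assume "2 dvd a"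
  then obtain b where "a = 2 * b"
    by (rule dvdE)
  then have "fps_nth a n = fps_nth b n + fps_nth b n" for n
    by (simp only: mult_2 fps_add_nth)
  then show "\<forall>n. even (fps_nth a n)"
    by simp
next
  assume "\<forall>n. even (fps_nth a n)"
  then have "fps_nth a n = fps_nth a n div 2 + fps_nth a n div 2" for n
    by (metis dvd_mult_div_cancel mult_2)
  then have "a = 2 * Abs_fps (\<lambda>n. fps_nth a n div 2)"
    by (intro fps_ext) (simp only: mult_2 fps_add_nth fps_nth_Abs_fps)
  then show "2 dvd a"
    by (rule dvdI)
qed

text \<open>For a single factor, (1 - y)^2 and 1 - y^2 differ by 2(y^2 - y); induction carries this
  over to products.\<close>

lemma two_dvd_prod_square_diff:
  fixes y :: "nat \<Rightarrow> 'a::comm_ring_1"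
  assumes "finite S"
  shows "2 dvd (\<Prod>i\<in>S. 1 - y i) ^ 2 - (\<Prod>i\<in>S. 1 - y i ^ 2)"
  using assms
proof (induction S rule: finite_induct)
  case (insert i S)
  let ?P = "\<Prod>i\<in>S. 1 - y i" and ?Q = "\<Prod>i\<in>S. 1 - y i ^ 2"
  have "((1 - y i) * ?P) ^ 2 - (1 - y i ^ 2) * ?Q
      = (1 - y i) ^ 2 * (?P ^ 2 - ?Q) + 2 * ((y i ^ 2 - y i) * ?Q)"
    by (simp add: algebra_simps power2_eq_square)
  then show ?case
    using insert by simp
qed simp

text \<open>Coefficients up to \<open>n\<close> depend only on the factors with index at most
  \<open>n\<close>, so the congruence for finite products suffices.\<close>

lemma eta_prod_square_cong:
  assumes "k > 0"
  shows "2 dvd eta_prod k ^ 2 - eta_prod (2 * k)"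
  unfolding two_dvd_fps_iff
proof
  fix n
  let ?P = "\<lambda>k. \<Prod>i\<le>n. 1 - fps_X ^ (k * Suc i) :: int fps"
  have "fps_nth (eta_prod k ^ 2) n = fps_nth (?P k ^ 2) n"
    unfolding power2_eq_square fps_mult_nth
    using assms by (intro sum.cong refl) (simp only: eta_prod_nth[of k _ n] atLeastAtMost_iff diff_le_self)
  moreover have "fps_nth (eta_prod (2 * k)) n = fps_nth (?P (2 * k)) n"
    using assms by (intro eta_prod_nth) simp_all
  moreover have "?P (2 * k) = (\<Prod>i\<le>n. 1 - (fps_X ^ (k * Suc i)) ^ 2)"
    by (intro prod.cong refl) (simp only: power_mult[symmetric] mult.commute mult.left_commute)
  moreover have "2 dvd ?P k ^ 2 - (\<Prod>i\<le>n. 1 - (fps_X ^ (k * Suc i)) ^ 2)"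
    by (rule two_dvd_prod_square_diff) simp
  ultimately show "even (fps_nth (eta_prod k ^ 2 - eta_prod (2 * k)) n)"
    unfolding two_dvd_fps_iff by (simp only: fps_sub_nth)
qed

text \<open>Replacing the square of \<open>eta_prod 2\<close> by \<open>eta_prod 4\<close> modulo 2
  in \<open>EO_u_gf\<close> leaves a common factor \<open>eta_prod 4\<close>, which cancels because
  it is invertible.\<close>

lemma even_EO_u_iff: "even (EO_u n) \<longleftrightarrow> even (fps_nth (eta_prod 4) n)"
proof -
  let ?E = "Abs_fps EO_u" and ?I = "fps_right_inverse (eta_prod 4) 1"
  have inv: "eta_prod 4 * ?I = 1"
    by (rule fps_right_inverse) (simp add: eta_prod_has_prod(2))
  have "2 dvd ?E * (eta_prod 2 ^ 2 - eta_prod 4)"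
    using eta_prod_square_cong[of 2] by simp
  also have "?E * (eta_prod 2 ^ 2 - eta_prod 4) = eta_prod 4 * (eta_prod 4 - ?E)"
    using EO_u_gf by (simp add: algebra_simps power2_eq_square)
  finally have "2 dvd (eta_prod 4 * (eta_prod 4 - ?E)) * ?I"
    by (rule dvd_mult2)
  also have "(eta_prod 4 * (eta_prod 4 - ?E)) * ?I = (eta_prod 4 * ?I) * (eta_prod 4 - ?E)"
    by (simp only: mult_ac)
  finally have "2 dvd eta_prod 4 - ?E"
    unfolding inv by simp
  then show ?thesis
    unfolding two_dvd_fps_iff by simp
qed

section \<open>Residues modulo p and the conclusion\<close>

lemma cong_abs_le_half:
  fixes a p :: int
  assumes "odd p" "p > 0"
  obtains k where "\<bar>k\<bar> \<le> (p - 1) div 2" "[k = a] (mod p)"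
proof -
  define h where "h = (p - 1) div 2"
  have p: "p = 2 * h + 1"
    using assms(1) by (auto simp: h_def elim: oddE)
  have "0 \<le> (a + h) mod p" "(a + h) mod p < p"
    using assms(2) by simp_all
  \<comment> \<open>Shifting by \<open>h\<close> before reducing and back afterwards turns the
    residues from 0 to 2h into those from -h to h.\<close>
  then have "\<bar>(a + h) mod p - h\<bar> \<le> h"
    unfolding p by linarith
  moreover have "[(a + h) mod p - h = a] (mod p)"
    by (simp add: cong_def mod_diff_left_eq)
  ultimately show ?thesis
    using that by (simp add: h_def)
qed

theorem theorem3p2:
  fixes g p i :: nat and \<epsilon> :: int
  assumes "g \<ge> 1"
    and "\<epsilon> \<in> {1, -1}"
    and "int p = 6 * int g + \<epsilon>"
    and "i \<le> p - 1"
    and "\<not> [int i = (int p ^ 2 - 1) div 12] (mod int p)"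
    and "\<And>k :: int. 1 \<le> k \<Longrightarrow> k \<le> (int p - 1) div 2 \<Longrightarrow>
           \<not> [int i = (k - int g) * (3 * k - 3 * int g - \<epsilon>)] (mod int p)"
  shows "\<forall>n :: nat. [EO_u (2 * p * n + 2 * i) = 0] (mod 2)"
proof (rule ccontr)
  define c where "c = int g * (3 * int g + \<epsilon>)"
  have eps2: "\<epsilon> * \<epsilon> = 1"
    using assms(2) by auto
  have c: "(int p ^ 2 - 1) div 12 = c"
  proof -
    have "int p ^ 2 - 1 = 12 * c"
      unfolding assms(3) c_def using eps2 by (simp add: algebra_simps power2_eq_square)
    then show ?thesis by simp
  qed
  have quad: "(k - int g) * (3 * k - 3 * int g - \<epsilon>) = 3 * k ^ 2 + c + int p * (- k)" for k
    unfolding assms(3) c_def by (simp add: algebra_simps power2_eq_square)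
  assume "\<not> (\<forall>n :: nat. [EO_u (2 * p * n + 2 * i) = 0] (mod 2))"
  then obtain n where "odd (EO_u (2 * p * n + 2 * i))"
    by (auto simp: cong_0_iff)
  then have "fps_nth (eta_prod 4) (2 * p * n + 2 * i) \<noteq> 0"
    unfolding even_EO_u_iff by auto
  then obtain m where "2 * int (2 * p * n + 2 * i) = int 4 * (m * (3 * m - 1))"
    by (rule eta_prod_nth_nonzero[OF zero_less_numeral])
  then have m: "int p * int n + int i = m * (3 * m - 1)"
    by (simp add: algebra_simps)
  \<comment> \<open>Chosen so that \<open>a - int g\<close> is \<epsilon>m: since \<epsilon> is its
    own inverse, \<epsilon>m(3\<epsilon>m - \<epsilon>) = m(3m - 1) for both signs.\<close>
  define a where "a = \<epsilon> * m + int g"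
  have "m * (3 * m - 1) = (a - int g) * (3 * a - 3 * int g - \<epsilon>)"
    using assms(2) by (auto simp: a_def algebra_simps)
  then have "int i = 3 * a ^ 2 + c + int p * (- a - int n)"
    using m unfolding quad by (simp add: algebra_simps)
  then have ia: "[int i = 3 * a ^ 2 + c] (mod int p)"
    by (simp add: cong_def mod_mult_self2)
  have "odd (int p)" "int p > 0"
    using assms(1-3) by auto presburger+
  then obtain k where k: "\<bar>k\<bar> \<le> (int p - 1) div 2" "[k = a] (mod int p)"
    by (rule cong_abs_le_half)
  have "[3 * k ^ 2 + c = 3 * a ^ 2 + c] (mod int p)"
    using k(2) by (intro cong_add cong_mult cong_pow cong_refl)
  then have ik: "[int i = 3 * k ^ 2 + c] (mod int p)"
    using ia by (blast intro: cong_trans cong_sym)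
  \<comment> \<open>The case \<open>k = 0\<close> gives the first excluded residue. Otherwise only
    the square of \<open>k\<close> matters modulo \<open>p\<close>, so \<open>\<bar>k\<bar>\<close>
    lies in the range of the second exclusion and yields the same residue.\<close>
  show False
  proof (cases "k = 0")
    case True
    then show ?thesis
      using ik assms(5) by (simp add: c)
  next
    case False
    have "[int i = (\<bar>k\<bar> - int g) * (3 * \<bar>k\<bar> - 3 * int g - \<epsilon>)] (mod int p)"
      unfolding quad using ik by (simp only: cong_def mod_mult_self2 power2_abs)
    then show ?thesis
      using assms(6)[of "\<bar>k\<bar>"] False k(1) by simp
  qed
qed

end
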